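(* Let $0\le q\in L_1^{loc}(\mathbb{R})$ and $p\in[1,\infty)$. If the equation $-y'(x)+q(x)y(x)=f(x)$, $x\in\mathbb{R}$, is correctly solvable in $L_p(\mathbb{R})$, then $\int_{-\infty}^{\infty}q(\xi)\,d\xi=\infty$.
   Context: A solution is an absolutely continuous function satisfying the equation a.e. The equation is correctly solvable in $L_p(\mathbb{R})$ if for every $f\in L_p(\mathbb{R})$ there is a unique solution $y\in L_p(\mathbb{R})$, and there is a constant $c(p)\in(0,\infty)$ with $\|y\|_p\le c(p)\|f\|_p$ for all $f\in L_p(\mathbb{R})$. *)

theory Defs
  imports "HOL-Analysis.Analysis"
begin

text \<open>Absolute continuity of y on the compact interval [a,b] (classical epsilon-delta
  definition with finite families of non-overlapping subintervals, given as pairs (s,t)).\<close>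
definition abs_cont_on :: "real \<Rightarrow> real \<Rightarrow> (real \<Rightarrow> real) \<Rightarrow> bool" where
  "abs_cont_on a b y \<longleftrightarrow>
     (\<forall>\<epsilon>>0. \<exists>\<delta>>0. \<forall>I :: (real \<times> real) set.
        finite I \<and> (\<forall>(s,t)\<in>I. a \<le> s \<and> s \<le> t \<and> t \<le> b) \<and>
        (\<forall>(s,t)\<in>I. \<forall>(s',t')\<in>I. (s,t) \<noteq> (s',t') \<longrightarrow> {s<..<t} \<inter> {s'<..<t'} = {}) \<and>
        (\<Sum>(s,t)\<in>I. t - s) < \<delta>
        \<longrightarrow> (\<Sum>(s,t)\<in>I. \<bar>y t - y s\<bar>) < \<epsilon>)"

text \<open>Absolutely continuous function on the real line: absolutely continuous on every
  compact interval.\<close>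
definition abs_cont :: "(real \<Rightarrow> real) \<Rightarrow> bool" where
  "abs_cont y \<longleftrightarrow> (\<forall>a b. abs_cont_on a b y)"

definition locally_integrable :: "(real \<Rightarrow> real) \<Rightarrow> bool" where
  "locally_integrable q \<longleftrightarrow> (\<forall>a b. set_integrable lebesgue {a..b} q)"

text \<open>Membership in L_p(R) and the L_p norm (1 <= p < infinity).\<close>
definition in_Lp :: "real \<Rightarrow> (real \<Rightarrow> real) \<Rightarrow> bool" where
  "in_Lp p f \<longleftrightarrow> f \<in> borel_measurable lebesgue \<and> integrable lebesgue (\<lambda>x. \<bar>f x\<bar> powr p)"

definition Lp_norm :: "real \<Rightarrow> (real \<Rightarrow> real) \<Rightarrow> real" where
  "Lp_norm p f = (\<integral>x. \<bar>f x\<bar> powr p \<partial>lebesgue) powr (1 / p)"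

text \<open>y is a solution of  -y'(x) + q(x) y(x) = f(x): y absolutely continuous and the
  equation holds almost everywhere.\<close>
definition is_solution :: "(real \<Rightarrow> real) \<Rightarrow> (real \<Rightarrow> real) \<Rightarrow> (real \<Rightarrow> real) \<Rightarrow> bool" where
  "is_solution q f y \<longleftrightarrow> abs_cont y \<and>
     (AE x in lebesgue. \<exists>d. (y has_real_derivative d) (at x) \<and> - d + q x * y x = f x)"

definition correctly_solvable :: "(real \<Rightarrow> real) \<Rightarrow> real \<Rightarrow> bool" where
  "correctly_solvable q p \<longleftrightarrow>
     (\<forall>f. in_Lp p f \<longrightarrow> (\<exists>!y. in_Lp p y \<and> is_solution q f y)) \<and>
     (\<exists>c>0. \<forall>f y. in_Lp p f \<longrightarrow> in_Lp p y \<longrightarrow> is_solution q f y \<longrightarrow>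
        Lp_norm p y \<le> c * Lp_norm p f)"

end

theory Submission
  imports Defs
begin

text \<open>Suppose the integral of q is finite, and let y be the L_p solution for f the indicator of [0,1].
Wherever y > 0 we have y' \<le> q y, so ln y drops by at most the total integral K of q when moving to
the left; a single positive value y(t) would give y \<ge> y(t) e^{-K} on (-\<infinity>, t], which is not in
L_p. Hence y \<le> 0 and y' = q y - f \<le> -f, so y(1) \<le> y(0) - 1 \<le> -1 and y is nonincreasing on
[1, \<infinity>), again contradicting y \<in> L_p.

All derivative estimates rest on G(b) - G(a) \<le> \<integral> h over [a, b] for absolutely continuous G with
G' \<le> h a.e. and h \<ge> 0: the values between G(a) and G(b) are attained either where G' \<ge> 0, a set
whose image has measure at most \<integral> h by the area inequality, or on a null set, whose image is null
by Luzin's property (N).\<close>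

definition nonoverlapping_intervals :: "real \<Rightarrow> real \<Rightarrow> (real \<times> real) set \<Rightarrow> bool" where
  "nonoverlapping_intervals a b I \<longleftrightarrow> finite I \<and> (\<forall>(s,t)\<in>I. a \<le> s \<and> s \<le> t \<and> t \<le> b) \<and>
     (\<forall>(s,t)\<in>I. \<forall>(s',t')\<in>I. (s,t) \<noteq> (s',t') \<longrightarrow> {s<..<t} \<inter> {s'<..<t'} = {})"

lemma nonoverlapping_intervalsD:
  "nonoverlapping_intervals a b I \<Longrightarrow> (s, t) \<in> I \<Longrightarrow> a \<le> s \<and> s \<le> t \<and> t \<le> b"
  unfolding nonoverlapping_intervals_def by fast

lemma abs_cont_on_iff:
  "abs_cont_on a b G \<longleftrightarrow> (\<forall>\<epsilon>>0. \<exists>\<delta>>0. \<forall>I. nonoverlapping_intervals a b I \<longrightarrow>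
     (\<Sum>(s,t)\<in>I. t - s) < \<delta> \<longrightarrow> (\<Sum>(s,t)\<in>I. \<bar>G t - G s\<bar>) < \<epsilon>)"
  unfolding abs_cont_on_def nonoverlapping_intervals_def by meson

lemma abs_cont_onE:
  assumes "abs_cont_on a b G" and "\<epsilon> > 0"
  obtains \<delta> where "\<delta> > 0"
    and "\<forall>F s t. finite F \<longrightarrow> (\<forall>i\<in>F. a \<le> s i \<and> s i \<le> t i \<and> t i \<le> b) \<longrightarrow>
           (\<forall>i\<in>F. \<forall>j\<in>F. i \<noteq> j \<longrightarrow> {s i<..<t i} \<inter> {s j<..<t j} = {}) \<longrightarrow>
           (\<Sum>i\<in>F. t i - s i) < \<delta> \<longrightarrow> (\<Sum>i\<in>F. \<bar>G (t i) - G (s i)\<bar>) < \<epsilon>"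
proof -
  obtain \<delta> where "\<delta> > 0" and \<delta>: "\<And>I. nonoverlapping_intervals a b I \<Longrightarrow>
      (\<Sum>(s,t)\<in>I. t - s) < \<delta> \<Longrightarrow> (\<Sum>(s,t)\<in>I. \<bar>G t - G s\<bar>) < \<epsilon>"
    using assms unfolding abs_cont_on_iff by meson
  show thesis
  proof (rule that[OF \<open>\<delta> > 0\<close>], intro allI impI)
    fix F and s t :: "_ \<Rightarrow> real"
    assume F: "finite F" and st: "\<forall>i\<in>F. a \<le> s i \<and> s i \<le> t i \<and> t i \<le> b"
      and disj: "\<forall>i\<in>F. \<forall>j\<in>F. i \<noteq> j \<longrightarrow> {s i<..<t i} \<inter> {s j<..<t j} = {}"
      and small: "(\<Sum>i\<in>F. t i - s i) < \<delta>"
    \<comment> \<open>Degenerate intervals contribute nothing; the others are distinct, so the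
      family becomes a set of pairs.\<close>
    define F' where "F' = {i\<in>F. s i < t i}"
    define p where "p i = (s i, t i)" for i
    have inj: "inj_on p F'"
    proof (rule inj_onI)
      fix i j assume ij: "i \<in> F'" "j \<in> F'" "p i = p j"
      then have "{s i<..<t i} \<inter> {s j<..<t j} \<noteq> {}"
        by (auto simp: F'_def p_def dest: dense)
      then show "i = j" using disj ij by (auto simp: F'_def)
    qed
    have sum_eq: "(\<Sum>i\<in>F. u (s i) (t i)) = (\<Sum>(s,t)\<in>p ` F'. u s t)"
      if "\<And>x. u x x = 0" for u :: "real \<Rightarrow> real \<Rightarrow> real"
    proof -
      have "(\<Sum>i\<in>F. u (s i) (t i)) = (\<Sum>i\<in>F'. u (s i) (t i))"
        using F st that by (intro sum.mono_neutral_right) (auto simp: F'_def, metis order.order_iff_strict)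
      also have "\<dots> = (\<Sum>(s,t)\<in>p ` F'. u s t)"
        unfolding sum.reindex[OF inj] by (simp add: p_def)
      finally show ?thesis .
    qed
    have "nonoverlapping_intervals a b (p ` F')"
      using F st disj by (auto simp: nonoverlapping_intervals_def F'_def p_def)
    then show "(\<Sum>i\<in>F. \<bar>G (t i) - G (s i)\<bar>) < \<epsilon>"
      using \<delta> small sum_eq[of "\<lambda>s t. t - s"] sum_eq[of "\<lambda>s t. \<bar>G t - G s\<bar>"] by simp
  qed
qed

lemma abs_cont_on_imp_continuous_on:
  assumes "abs_cont_on a b G"
  shows "continuous_on {a..b} G"
  unfolding continuous_on_iff
proof (intro ballI allI impI)
  fix x \<epsilon> :: real assume x: "x \<in> {a..b}" and "\<epsilon> > 0"
  obtain \<delta> where "\<delta> > 0" and \<delta>: "\<And>I. nonoverlapping_intervals a b I \<Longrightarrow>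
      (\<Sum>(s,t)\<in>I. t - s) < \<delta> \<Longrightarrow> (\<Sum>(s,t)\<in>I. \<bar>G t - G s\<bar>) < \<epsilon>"
    using assms \<open>\<epsilon> > 0\<close> unfolding abs_cont_on_iff by meson
  have "dist (G x') (G x) < \<epsilon>" if x': "x' \<in> {a..b}" "dist x' x < \<delta>" for x'
  proof -
    have "nonoverlapping_intervals a b {(min x x', max x x')}"
      using x x' by (auto simp: nonoverlapping_intervals_def)
    then have "\<bar>G (max x x') - G (min x x')\<bar> < \<epsilon>"
      using \<delta> x' by (fastforce simp: dist_real_def)
    then show ?thesis
      by (simp add: dist_real_def min_def max_def abs_minus_commute split: if_splits)
  qed
  with \<open>\<delta> > 0\<close> show "\<exists>\<delta>>0. \<forall>x'\<in>{a..b}. dist x' x < \<delta> \<longrightarrow> dist (G x') (G x) < \<epsilon>"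
    by blast
qed

lemma abs_cont_on_ident: "abs_cont_on a b (\<lambda>x. x)"
  unfolding abs_cont_on_iff
proof (intro allI impI exI conjI)
  fix \<epsilon> :: real assume "\<epsilon> > 0"
  then show "\<epsilon> > 0" .
  fix I assume I: "nonoverlapping_intervals a b I" and small: "(\<Sum>(s,t)\<in>I. t - s) < \<epsilon>"
  have "(\<Sum>(s,t)\<in>I. \<bar>t - s\<bar>) = (\<Sum>(s,t)\<in>I. t - s)"
    by (rule sum.cong) (auto dest: nonoverlapping_intervalsD[OF I])
  with small show "(\<Sum>(s,t)\<in>I. \<bar>t - s\<bar>) < \<epsilon>" by simp
qed

lemma abs_cont_on_compose_lipschitz:
  assumes "abs_cont_on a b G" and "L-lipschitz_on (G ` {a..b}) \<phi>"
  shows "abs_cont_on a b (\<lambda>x. \<phi> (G x))"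
  unfolding abs_cont_on_iff
proof (intro allI impI)
  fix \<epsilon> :: real assume "\<epsilon> > 0"
  have L: "0 \<le> L" using lipschitz_on_nonneg[OF assms(2)] .
  then obtain \<delta> where "\<delta> > 0" and \<delta>: "\<And>I. nonoverlapping_intervals a b I \<Longrightarrow>
      (\<Sum>(s,t)\<in>I. t - s) < \<delta> \<Longrightarrow> (\<Sum>(s,t)\<in>I. \<bar>G t - G s\<bar>) < \<epsilon> / (L + 1)"
    using assms(1) \<open>\<epsilon> > 0\<close> unfolding abs_cont_on_iff
    by (metis add_nonneg_pos divide_pos_pos zero_less_one)
  show "\<exists>\<delta>>0. \<forall>I. nonoverlapping_intervals a b I \<longrightarrow>
     (\<Sum>(s,t)\<in>I. t - s) < \<delta> \<longrightarrow> (\<Sum>(s,t)\<in>I. \<bar>\<phi> (G t) - \<phi> (G s)\<bar>) < \<epsilon>"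
  proof (intro exI[of _ \<delta>] conjI allI impI \<open>\<delta> > 0\<close>)
    fix I assume I: "nonoverlapping_intervals a b I" and small: "(\<Sum>(s,t)\<in>I. t - s) < \<delta>"
    have "(\<Sum>(s,t)\<in>I. \<bar>\<phi> (G t) - \<phi> (G s)\<bar>) \<le> (\<Sum>(s,t)\<in>I. L * \<bar>G t - G s\<bar>)"
    proof (intro sum_mono, clarify)
      fix s t assume "(s, t) \<in> I"
      with I have "s \<in> {a..b}" "t \<in> {a..b}" by (auto dest: nonoverlapping_intervalsD)
      then show "\<bar>\<phi> (G t) - \<phi> (G s)\<bar> \<le> L * \<bar>G t - G s\<bar>"
        using lipschitz_onD[OF assms(2), of "G t" "G s"] by (simp add: dist_real_def)
    qed
    also have "\<dots> = L * (\<Sum>(s,t)\<in>I. \<bar>G t - G s\<bar>)"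
      by (simp add: sum_distrib_left case_prod_unfold)
    also have "\<dots> \<le> L * (\<epsilon> / (L + 1))"
      using \<delta>[OF I small] L by (intro mult_left_mono) auto
    also have "\<dots> < \<epsilon>"
      using \<open>\<epsilon> > 0\<close> L by (simp add: field_simps)
    finally show "(\<Sum>(s,t)\<in>I. \<bar>\<phi> (G t) - \<phi> (G s)\<bar>) < \<epsilon>" .
  qed
qed

lemma abs_cont_on_add:
  assumes "abs_cont_on a b G" and "abs_cont_on a b H"
  shows "abs_cont_on a b (\<lambda>x. G x + H x)"
  unfolding abs_cont_on_iff
proof (intro allI impI)
  fix \<epsilon> :: real assume "\<epsilon> > 0"
  then obtain \<delta>1 \<delta>2 where "\<delta>1 > 0" "\<delta>2 > 0"
    and \<delta>1: "\<And>I. nonoverlapping_intervals a b I \<Longrightarrow>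
      (\<Sum>(s,t)\<in>I. t - s) < \<delta>1 \<Longrightarrow> (\<Sum>(s,t)\<in>I. \<bar>G t - G s\<bar>) < \<epsilon> / 2"
    and \<delta>2: "\<And>I. nonoverlapping_intervals a b I \<Longrightarrow>
      (\<Sum>(s,t)\<in>I. t - s) < \<delta>2 \<Longrightarrow> (\<Sum>(s,t)\<in>I. \<bar>H t - H s\<bar>) < \<epsilon> / 2"
    using assms unfolding abs_cont_on_iff by (metis half_gt_zero)
  show "\<exists>\<delta>>0. \<forall>I. nonoverlapping_intervals a b I \<longrightarrow>
     (\<Sum>(s,t)\<in>I. t - s) < \<delta> \<longrightarrow> (\<Sum>(s,t)\<in>I. \<bar>(G t + H t) - (G s + H s)\<bar>) < \<epsilon>"
  proof (intro exI[of _ "min \<delta>1 \<delta>2"] conjI allI impI)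
    show "min \<delta>1 \<delta>2 > 0" using \<open>\<delta>1 > 0\<close> \<open>\<delta>2 > 0\<close> by simp
    fix I assume I: "nonoverlapping_intervals a b I" and small: "(\<Sum>(s,t)\<in>I. t - s) < min \<delta>1 \<delta>2"
    have "(\<Sum>(s,t)\<in>I. \<bar>(G t + H t) - (G s + H s)\<bar>) \<le> (\<Sum>(s,t)\<in>I. \<bar>G t - G s\<bar> + \<bar>H t - H s\<bar>)"
      by (intro sum_mono) auto
    also have "\<dots> = (\<Sum>(s,t)\<in>I. \<bar>G t - G s\<bar>) + (\<Sum>(s,t)\<in>I. \<bar>H t - H s\<bar>)"
      by (simp add: sum.distrib case_prod_unfold)
    also have "\<dots> < \<epsilon> / 2 + \<epsilon> / 2"
      using \<delta>1[OF I] \<delta>2[OF I] small by (intro add_strict_mono) auto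
    finally show "(\<Sum>(s,t)\<in>I. \<bar>(G t + H t) - (G s + H s)\<bar>) < \<epsilon>" by simp
  qed
qed

lemma component_interval_bounds:
  fixes C V :: "real set"
  assumes C: "C \<in> components V" and V: "V \<subseteq> {a<..<b}"
  shows "a \<le> Inf C" "Sup C \<le> b" "C \<subseteq> {Inf C..Sup C}" "{Inf C<..<Sup C} \<subseteq> C"
proof -
  have ne: "C \<noteq> {}" using C in_components_nonempty by blast
  have sub: "C \<subseteq> {a<..<b}" using C V in_components_subset by blast
  have bdd: "bdd_below C" "bdd_above C"
    using sub by (auto intro!: bdd_belowI[where m=a] bdd_aboveI[where M=b])
  have iv: "is_interval C" using C in_components_connected is_interval_connected_1 by blast
  show "a \<le> Inf C" using ne sub by (intro cInf_greatest) auto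
  show "Sup C \<le> b" using ne sub by (intro cSup_least) auto
  show "C \<subseteq> {Inf C..Sup C}" using bdd by (auto intro: cInf_lower cSup_upper)
  show "{Inf C<..<Sup C} \<subseteq> C"
  proof
    fix w assume w: "w \<in> {Inf C<..<Sup C}"
    obtain u v where "u \<in> C" "u < w" "v \<in> C" "w < v"
      using w ne bdd by (meson cInf_less_iff less_cSup_iff greaterThanLessThan_iff)
    then show "w \<in> C" using iv unfolding is_interval_1 by (meson less_imp_le)
  qed
qed

lemma abs_cont_on_components_sum:
  assumes "abs_cont_on a b G" and "\<epsilon> > 0"
  obtains \<delta> where "\<delta> > 0"
    and "\<And>V F m M. open V \<Longrightarrow> V \<subseteq> {a<..<b} \<Longrightarrow> measure lebesgue V < \<delta> \<Longrightarrow>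
      finite F \<Longrightarrow> F \<subseteq> components V \<Longrightarrow>
      (\<And>C. C \<in> F \<Longrightarrow> m C \<in> {Inf C..Sup C} \<and> M C \<in> {Inf C..Sup C}) \<Longrightarrow>
      (\<Sum>C\<in>F. \<bar>G (M C) - G (m C)\<bar>) < \<epsilon>"
proof -
  obtain \<delta> where "\<delta> > 0"
    and \<delta>: "\<forall>(F :: real set set) s t. finite F \<longrightarrow> (\<forall>i\<in>F. a \<le> s i \<and> s i \<le> t i \<and> t i \<le> b) \<longrightarrow>
           (\<forall>i\<in>F. \<forall>j\<in>F. i \<noteq> j \<longrightarrow> {s i<..<t i} \<inter> {s j<..<t j} = {}) \<longrightarrow>
           (\<Sum>i\<in>F. t i - s i) < \<delta> \<longrightarrow> (\<Sum>i\<in>F. \<bar>G (t i) - G (s i)\<bar>) < \<epsilon>"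
    by (rule abs_cont_onE[OF assms])
  show thesis
  proof (rule that[OF \<open>\<delta> > 0\<close>])
    fix V F and m M :: "real set \<Rightarrow> real"
    assume V: "open V" "V \<subseteq> {a<..<b}" "measure lebesgue V < \<delta>"
      and F: "finite F" "F \<subseteq> components V"
      and mM: "\<And>C. C \<in> F \<Longrightarrow> m C \<in> {Inf C..Sup C} \<and> M C \<in> {Inf C..Sup C}"
    note bounds = component_interval_bounds[OF _ V(2)]
    define s where "s C = min (m C) (M C)" for C
    define t where "t C = max (m C) (M C)" for C
    have st_bounds: "a \<le> s C \<and> s C \<le> t C \<and> t C \<le> b" if "C \<in> F" for C
      using that F mM[of C] bounds(1,2)[of C] by (auto simp: s_def t_def)
    have st_in: "{s C<..<t C} \<subseteq> C" if "C \<in> F" for C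
    proof -
      have "{s C<..<t C} \<subseteq> {Inf C<..<Sup C}"
        using mM[OF that] by (auto simp: s_def t_def min_def max_def)
      then show ?thesis using bounds(4)[of C] that F by blast
    qed
    have C_lmeasurable: "C \<in> lmeasurable" if "C \<in> F" for C
    proof (rule lmeasurable_open)
      show "open C" using V(1) open_components that F by blast
      show "bounded C"
        using bounds[of C] that F bounded_subset[OF bounded_closed_interval] by blast
    qed
    have disj: "pairwise disjnt F"
      using pairwise_subset[OF pairwise_disjoint_components F(2)] unfolding disjnt_def .
    have st_disj: "{s C<..<t C} \<inter> {s C'<..<t C'} = {}" if "C \<in> F" "C' \<in> F" "C \<noteq> C'" for C C'
      using st_in[of C] st_in[of C'] disj that unfolding pairwise_def disjnt_def by blast
    have "(\<Sum>C\<in>F. t C - s C) \<le> (\<Sum>C\<in>F. measure lebesgue C)"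
    proof (rule sum_mono)
      fix C assume "C \<in> F"
      have "t C - s C = measure lebesgue {s C<..<t C}" by (simp add: s_def t_def)
      also have "\<dots> \<le> measure lebesgue C"
        using st_in C_lmeasurable \<open>C \<in> F\<close> by (intro measure_mono_fmeasurable) auto
      finally show "t C - s C \<le> measure lebesgue C" .
    qed
    also have "\<dots> = measure lebesgue (\<Union>F)"
      using F(1) C_lmeasurable disj by (intro measure_Union'[symmetric]) auto
    also have "\<dots> \<le> measure lebesgue V"
    proof (rule measure_mono_fmeasurable)
      show "\<Union>F \<subseteq> V" using F(2) in_components_subset by blast
      show "\<Union>F \<in> sets lebesgue" using F(1) C_lmeasurable by (intro sets.finite_Union) auto
      have "V \<subseteq> {a..b}" using V(2) by auto
      then show "V \<in> lmeasurable"
        using V(1) bounded_subset[OF bounded_closed_interval] by (blast intro: lmeasurable_open)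
    qed
    finally have "(\<Sum>C\<in>F. t C - s C) < \<delta>" using V(3) by linarith
    then have "(\<Sum>C\<in>F. \<bar>G (t C) - G (s C)\<bar>) < \<epsilon>"
      using \<delta>[rule_format, OF F(1) st_bounds st_disj] by simp
    moreover have "\<bar>G (t C) - G (s C)\<bar> = \<bar>G (M C) - G (m C)\<bar>" for C
      by (simp add: s_def t_def min_def max_def abs_minus_commute)
    ultimately show "(\<Sum>C\<in>F. \<bar>G (M C) - G (m C)\<bar>) < \<epsilon>" by simp
  qed
qed

lemma abs_cont_on_image_open_small:
  assumes G: "abs_cont_on a b G" and "\<epsilon> > 0"
  obtains \<delta> where "\<delta> > 0" and "\<And>V. open V \<Longrightarrow> V \<subseteq> {a<..<b} \<Longrightarrow> measure lebesgue V < \<delta> \<Longrightarrow>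
    \<exists>T. G ` V \<subseteq> T \<and> T \<in> lmeasurable \<and> measure lebesgue T \<le> \<epsilon>"
proof (rule abs_cont_on_components_sum[OF assms])
  fix \<delta> assume "\<delta> > 0" and \<delta>: "\<And>V F m M. open V \<Longrightarrow> V \<subseteq> {a<..<b} \<Longrightarrow> measure lebesgue V < \<delta> \<Longrightarrow>
      finite F \<Longrightarrow> F \<subseteq> components V \<Longrightarrow>
      (\<And>C. C \<in> F \<Longrightarrow> m C \<in> {Inf C..Sup C} \<and> M C \<in> {Inf C..Sup C}) \<Longrightarrow>
      (\<Sum>C\<in>F. \<bar>G (M C) - G (m C)\<bar>) < \<epsilon>"
  show thesis
  proof (rule that[OF \<open>\<delta> > 0\<close>])
    fix V assume V: "open V" "V \<subseteq> {a<..<b}" "measure lebesgue V < \<delta>"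
    note bounds = component_interval_bounds[OF _ V(2)]
    have "\<exists>m M. m \<in> {Inf C..Sup C} \<and> M \<in> {Inf C..Sup C} \<and> G ` {Inf C..Sup C} \<subseteq> {G m..G M}"
      if "C \<in> components V" for C
    proof -
      have "{Inf C..Sup C} \<subseteq> {a..b}" using bounds[OF that] by auto
      then have "continuous_on {Inf C..Sup C} G"
        using abs_cont_on_imp_continuous_on[OF G] continuous_on_subset by blast
      moreover have "C \<noteq> {}" using that in_components_nonempty by blast
      then have "{Inf C..Sup C} \<noteq> {}" using bounds(3)[OF that] by auto
      ultimately obtain m M where "m \<in> {Inf C..Sup C}" "\<forall>x\<in>{Inf C..Sup C}. G m \<le> G x"
        and "M \<in> {Inf C..Sup C}" "\<forall>x\<in>{Inf C..Sup C}. G x \<le> G M"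
        using continuous_attains_inf[OF compact_Icc] continuous_attains_sup[OF compact_Icc] by metis
      then show ?thesis by (intro exI[of _ m] exI[of _ M]) auto
    qed
    then obtain m M where mM: "\<And>C. C \<in> components V \<Longrightarrow> m C \<in> {Inf C..Sup C} \<and>
        M C \<in> {Inf C..Sup C} \<and> G ` {Inf C..Sup C} \<subseteq> {G (m C)..G (M C)}"
      by metis
    have "countable (components V)"
    proof (rule countable_disjoint_open_subsets)
      show "pairwise disjnt (components V)"
        using pairwise_disjoint_components[of V] unfolding disjnt_def by simp
    qed (use open_components V(1) in blast)
    have measure_Icc_le_abs: "measure lebesgue {x..y} \<le> \<bar>y - x\<bar>" for x y :: real
      by (cases "x \<le> y") auto
    have finite_bound: "measure lebesgue (\<Union>C\<in>F. {G (m C)..G (M C)}) \<le> \<epsilon>"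
      if F: "F \<subseteq> components V" "finite F" for F
    proof -
      have "measure lebesgue (\<Union>C\<in>F. {G (m C)..G (M C)}) \<le> (\<Sum>C\<in>F. measure lebesgue {G (m C)..G (M C)})"
        using F(2) by (intro measure_UNION_le) auto
      also have "\<dots> \<le> (\<Sum>C\<in>F. \<bar>G (M C) - G (m C)\<bar>)"
        using measure_Icc_le_abs by (intro sum_mono) blast
      also have "\<dots> < \<epsilon>"
        using mM F by (intro \<delta>[OF V]) auto
      finally show ?thesis by simp
    qed
    have "G ` V \<subseteq> (\<Union>C\<in>components V. {G (m C)..G (M C)})"
    proof
      fix v assume "v \<in> G ` V"
      then obtain x where "x \<in> V" "v = G x" by blast
      then obtain C where C: "C \<in> components V" "x \<in> C" using Union_components[of V] by blast
      then have "v \<in> {G (m C)..G (M C)}" using mM[OF C(1)] bounds(3)[OF C(1)] \<open>v = G x\<close> by blast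
      with C show "v \<in> (\<Union>C\<in>components V. {G (m C)..G (M C)})" by blast
    qed
    moreover have "(\<Union>C\<in>components V. {G (m C)..G (M C)}) \<in> lmeasurable"
      by (rule fmeasurable_UN_bound[OF \<open>countable (components V)\<close> _ finite_bound]) auto
    moreover have "measure lebesgue (\<Union>C\<in>components V. {G (m C)..G (M C)}) \<le> \<epsilon>"
      by (rule measure_UN_bound[OF \<open>countable (components V)\<close> _ finite_bound]) auto
    ultimately show "\<exists>T. G ` V \<subseteq> T \<and> T \<in> lmeasurable \<and> measure lebesgue T \<le> \<epsilon>"
      by blast
  qed
qed

lemma abs_cont_on_negligible_image:
  assumes G: "abs_cont_on a b G" and N: "negligible N" "N \<subseteq> {a<..<b}"
  shows "negligible (G ` N)"
  unfolding negligible_outer_le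
proof (intro allI impI)
  fix \<epsilon> :: real assume "\<epsilon> > 0"
  obtain \<delta> where "\<delta> > 0" and \<delta>: "\<And>V. open V \<Longrightarrow> V \<subseteq> {a<..<b} \<Longrightarrow> measure lebesgue V < \<delta> \<Longrightarrow>
      \<exists>T. G ` V \<subseteq> T \<and> T \<in> lmeasurable \<and> measure lebesgue T \<le> \<epsilon>"
    using abs_cont_on_image_open_small[OF G \<open>\<epsilon> > 0\<close>] by metis
  obtain U where "open U" "N \<subseteq> U" "U - N \<in> lmeasurable" "emeasure lebesgue (U - N) < ennreal \<delta>"
    using sets_lebesgue_outer_open[OF negligible_imp_sets[OF N(1)] \<open>\<delta> > 0\<close>] by blast
  define V where "V = U \<inter> {a<..<b}"
  have "V \<in> lmeasurable"
  proof (rule lmeasurable_open)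
    show "bounded V" using bounded_subset[OF bounded_closed_interval, of V a b] by (auto simp: V_def)
  qed (simp add: V_def \<open>open U\<close> open_Int)
  moreover have "V \<subseteq> (U - N) \<union> N" by (auto simp: V_def)
  moreover have "(U - N) \<union> N \<in> lmeasurable"
    using \<open>U - N \<in> lmeasurable\<close> negligible_imp_measurable[OF N(1)] by (rule fmeasurable.Un)
  ultimately have "measure lebesgue V \<le> measure lebesgue ((U - N) \<union> N)"
    by (intro measure_mono_fmeasurable) auto
  also have "\<dots> \<le> measure lebesgue (U - N) + measure lebesgue N"
    using \<open>U - N \<in> lmeasurable\<close> N(1) by (intro measure_Un_le) (auto simp: negligible_imp_sets)
  also have "\<dots> < \<delta>"
    using \<open>U - N \<in> lmeasurable\<close> \<open>emeasure lebesgue (U - N) < ennreal \<delta>\<close> N(1)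
    by (simp add: emeasure_eq_measure2 ennreal_less_iff negligible_imp_measure0)
  finally have "measure lebesgue V < \<delta>" .
  moreover have "open V" using \<open>open U\<close> by (simp add: V_def open_Int)
  ultimately have "\<exists>T. G ` V \<subseteq> T \<and> T \<in> lmeasurable \<and> measure lebesgue T \<le> \<epsilon>"
    using \<delta>[of V] by (simp add: V_def)
  then obtain T where T: "G ` V \<subseteq> T" "T \<in> lmeasurable" "measure lebesgue T \<le> \<epsilon>"
    by blast
  have "G ` N \<subseteq> G ` V" using \<open>N \<subseteq> U\<close> N(2) by (auto simp: V_def)
  with T show "\<exists>T. G ` N \<subseteq> T \<and> T \<in> lmeasurable \<and> measure lebesgue T \<le> \<epsilon>"
    by (intro exI[of _ T]) auto
qed

lemma measure_image_le_integral_abs_deriv: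
  fixes G g :: "real \<Rightarrow> real"
  assumes S: "S \<in> sets lebesgue"
    and der: "\<And>x. x \<in> S \<Longrightarrow> (G has_real_derivative g x) (at x within S)"
    and int: "(\<lambda>x. \<bar>g x\<bar>) integrable_on S"
  shows "G ` S \<in> lmeasurable" and "measure lebesgue (G ` S) \<le> integral S (\<lambda>x. \<bar>g x\<bar>)"
proof -
  \<comment> \<open>The area inequality measure_differentiable_image, transported from real^1 to real.\<close>
  let ?lift = "vec :: real \<Rightarrow> real^1"
  let ?drop = "(\<lambda>x::real^1. x $ 1)"
  have S': "?lift ` S \<in> sets lebesgue"
    by (auto intro: differentiable_image_in_sets_lebesgue [OF S] differentiable_vec)
  have "((\<lambda>x. vec (G (x $ 1))) has_derivative (*\<^sub>R) (g z)) (at (vec z) within ?lift ` S)"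
    if "z \<in> S" for z
    using der [OF that]
    by (simp add: has_real_derivative_iff_has_vector_derivative has_vector_derivative_def has_derivative_vector_1)
  then have der': "\<And>x. x \<in> ?lift ` S \<Longrightarrow>
        (?lift \<circ> G \<circ> ?drop has_derivative (*\<^sub>R) (g (?drop x))) (at x within ?lift ` S)"
    by (auto simp: o_def)
  have det: "det (matrix ((*\<^sub>R) c :: real^1 \<Rightarrow> real^1)) = c" for c :: real
    by (simp add: det_1 matrix_def)
  have int': "(\<lambda>x. \<bar>det (matrix ((*\<^sub>R) (g (?drop x)) :: real^1 \<Rightarrow> real^1))\<bar>) integrable_on ?lift ` S"
  proof -
    have "((\<lambda>x. \<bar>g x\<bar>) has_integral integral S (\<lambda>x. \<bar>g x\<bar>)) S" using int by blast
    then have "((\<lambda>x. \<bar>g (?drop x)\<bar>) \<circ> vec has_integral integral S (\<lambda>x. \<bar>g x\<bar>)) (?drop ` ?lift ` S)"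
      by (simp add: o_def image_image)
    then have "((\<lambda>x. \<bar>g (?drop x)\<bar>) has_integral integral S (\<lambda>x. \<bar>g x\<bar>)) (?lift ` S)"
      by (rule has_integral_vec1_D)
    then show ?thesis by (simp add: det integrable_on_def) blast
  qed
  have M: "(?lift \<circ> G \<circ> ?drop) ` ?lift ` S \<in> lmeasurable"
    and Mle: "measure lebesgue ((?lift \<circ> G \<circ> ?drop) ` ?lift ` S) \<le> integral (?lift ` S) (\<lambda>x. \<bar>det (matrix ((*\<^sub>R) (g (?drop x)) :: real^1 \<Rightarrow> real^1))\<bar>)"
    using measurable_differentiable_image[OF S' der' int'] measure_differentiable_image[OF S' der' int'] by auto
  have eqim: "(?lift \<circ> G \<circ> ?drop) ` ?lift ` S = ?lift ` (G ` S)"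
    by (auto simp: image_image)
  have eqint: "integral (?lift ` S) (\<lambda>x. \<bar>det (matrix ((*\<^sub>R) (g (?drop x)) :: real^1 \<Rightarrow> real^1))\<bar>)
      = integral S (\<lambda>x. \<bar>g x\<bar>)"
    by (simp add: det integral_vec1_eq o_def image_image)
  have "(\<lambda>x. 1::real) integrable_on ?lift ` (G ` S)" using M eqim lmeasurable_iff_integrable_on by metis
  then have I1: "((\<lambda>x. 1::real) has_integral integral (?lift ` (G ` S)) (\<lambda>x. 1)) (?lift ` (G ` S))" by blast
  have I2: "((\<lambda>x. 1::real) has_integral integral (?lift ` (G ` S)) (\<lambda>x. 1)) (G ` S)"
    using has_integral_vec1_I[OF I1] by (simp add: o_def image_image)
  then show GS: "G ` S \<in> lmeasurable" using lmeasurable_iff_integrable_on by blast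
  have "measure lebesgue (G ` S) = integral (?lift ` (G ` S)) (\<lambda>x. 1)"
    using lmeasure_integral[OF GS] I2 by (simp add: integral_unique)
  also have "\<dots> = measure lebesgue (?lift ` (G ` S))"
    using lmeasure_integral M eqim by metis
  finally show "measure lebesgue (G ` S) \<le> integral S (\<lambda>x. \<bar>g x\<bar>)"
    using Mle eqim eqint by auto
qed

lemma borel_measurable_derivative:
  fixes G g :: "real \<Rightarrow> real"
  assumes contG: "continuous_on UNIV G" and D: "D \<in> sets lebesgue"
    and der: "\<And>x. x \<in> D \<Longrightarrow> (G has_real_derivative g x) (at x)"
  shows "g \<in> borel_measurable (lebesgue_on D)"
proof -
  define \<phi> where "\<phi> i x = (G (x + 1 / real (Suc i)) - G x) / (1 / real (Suc i))" for i x
  have "(\<lambda>x. if x \<in> D then g x else 0) \<in> borel_measurable lebesgue"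
  proof (rule borel_measurable_LIMSEQ_real)
    show "(\<lambda>x. if x \<in> D then \<phi> i x else 0) \<in> borel_measurable lebesgue" for i
    proof (rule borel_measurable_if_I[OF _ D])
      have "continuous_on UNIV (\<phi> i)" unfolding \<phi>_def
        by (intro continuous_intros continuous_on_compose2[OF contG]) auto
      then show "\<phi> i \<in> borel_measurable (lebesgue_on D)"
        using continuous_imp_measurable_on_sets_lebesgue[OF _ D] continuous_on_subset by blast
    qed
    fix x
    show "(\<lambda>i. if x \<in> D then \<phi> i x else 0) \<longlonglongrightarrow> (if x \<in> D then g x else 0)"
    proof (cases "x \<in> D")
      case True
      have "((\<lambda>y. (G y - G x) / (y - x)) \<longlongrightarrow> g x) (at x)"
        using der[OF True] by (simp add: has_field_derivative_iff)
      moreover have "(\<lambda>i. x + 1 / real (Suc i)) \<longlonglongrightarrow> x"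
        using tendsto_add[OF tendsto_const[of x] LIMSEQ_inverse_real_of_nat] by (simp add: inverse_eq_divide)
      ultimately have "((\<lambda>y. (G y - G x) / (y - x)) \<circ> (\<lambda>i. x + 1 / real (Suc i))) \<longlonglongrightarrow> g x"
        unfolding tendsto_at_iff_sequentially by auto
      then show ?thesis using True by (simp add: \<phi>_def o_def)
    qed simp
  qed
  then show ?thesis using borel_measurable_if_D by blast
qed

lemma borel_measurable_derivative_on_interval:
  fixes G g :: "real \<Rightarrow> real"
  assumes cont: "continuous_on {a..b} G" and "a \<le> b" and D: "D \<in> sets lebesgue" "D \<subseteq> {a<..<b}"
    and der: "\<And>x. x \<in> D \<Longrightarrow> (G has_real_derivative g x) (at x)"
  shows "g \<in> borel_measurable (lebesgue_on D)"
proof -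
  \<comment> \<open>Clamping the argument to [a,b] extends G continuously without changing it near D.\<close>
  define H where "H x = G (max a (min b x))" for x
  have H: "continuous_on UNIV H"
    unfolding H_def
    by (rule continuous_on_compose2[OF cont]) (use \<open>a \<le> b\<close> in \<open>auto intro!: continuous_intros\<close>)
  have H': "(H has_real_derivative g x) (at x)" if "x \<in> D" for x
  proof (rule has_field_derivative_transform_within_open[OF der[OF that] open_greaterThanLessThan])
    show "x \<in> {a<..<b}" using that D(2) by blast
  qed (simp add: H_def)
  show ?thesis by (rule borel_measurable_derivative[OF H D(1) H'])
qed

lemma last_crossing:
  fixes G :: "real \<Rightarrow> real"
  assumes cont: "continuous_on {a..b} G" and "a \<le> b" "G a \<le> v" "v < G b"
  obtains x where "a \<le> x" "x < b" "G x = v" "\<And>t. x < t \<Longrightarrow> t \<le> b \<Longrightarrow> v < G t"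
proof -
  define Z where "Z = {x\<in>{a..b}. G x = v}"
  have "Z \<noteq> {}" using IVT'[of G a v b] assms by (auto simp: Z_def)
  moreover have bdd: "bdd_above Z" by (auto simp: Z_def intro!: bdd_aboveI[where M=b])
  moreover have "closed Z"
    unfolding Z_def using continuous_closed_preimage_constant[OF cont closed_atLeastAtMost] by simp
  ultimately have "Sup Z \<in> Z" by (rule closed_contains_Sup)
  then have x: "a \<le> Sup Z" "Sup Z \<le> b" "G (Sup Z) = v" by (auto simp: Z_def)
  have above: "v < G t" if t: "Sup Z < t" "t \<le> b" for t
  proof (rule ccontr)
    assume "\<not> v < G t"
    moreover have "continuous_on {t..b} G"
      by (rule continuous_on_subset[OF cont]) (use x t in auto)
    ultimately obtain z where "t \<le> z" "z \<le> b" "G z = v"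
      using IVT'[of G t v b] t assms(4) by auto
    then have "z \<in> Z" using x t by (auto simp: Z_def)
    then show False using cSup_upper[OF _ bdd] \<open>Sup Z < t\<close> \<open>t \<le> z\<close> by fastforce
  qed
  have "Sup Z < b" using x assms(4) by (metis order_less_le)
  with x above show thesis by (intro that) auto
qed

lemma interval_subset_image_nonneg_derivative:
  fixes G g :: "real \<Rightarrow> real"
  assumes cont: "continuous_on {a..b} G" and "a \<le> b"
    and der: "\<And>x. x \<in> D \<Longrightarrow> (G has_real_derivative g x) (at x)"
  shows "{G a<..<G b} \<subseteq> G ` {x\<in>D. 0 \<le> g x} \<union> G ` ({a<..<b} - D)"
proof
  fix v assume v: "v \<in> {G a<..<G b}"
  then obtain x where x: "a \<le> x" "x < b" "G x = v" and above: "\<And>t. x < t \<Longrightarrow> t \<le> b \<Longrightarrow> v < G t"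
    using last_crossing[OF cont \<open>a \<le> b\<close>, of v] by auto
  have "x \<noteq> a" using v x by auto
  show "v \<in> G ` {x\<in>D. 0 \<le> g x} \<union> G ` ({a<..<b} - D)"
  proof (cases "x \<in> D")
    case True
    have "((\<lambda>y. (G y - G x) / (y - x)) \<longlongrightarrow> g x) (at_right x)"
      using der[OF True] unfolding has_field_derivative_iff by (rule tendsto_mono[OF at_le, rotated]) simp
    moreover have "\<forall>\<^sub>F y in at_right x. 0 \<le> (G y - G x) / (y - x)"
      unfolding eventually_at_right_field
      using x above by (intro exI[of _ b]) (auto intro: divide_nonneg_pos less_imp_le)
    ultimately have "0 \<le> g x" by (rule tendsto_lowerbound) simp
    with True x show ?thesis by auto
  next
    case False
    with x \<open>x \<noteq> a\<close> show ?thesis by auto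
  qed
qed

lemma measure_image_derivative_le_integral:
  fixes G g h :: "real \<Rightarrow> real"
  assumes cont: "continuous_on {a..b} G" and "a \<le> b" and S: "S \<in> sets lebesgue" "S \<subseteq> {a<..<b}"
    and der: "\<And>x. x \<in> S \<Longrightarrow> (G has_real_derivative g x) (at x)"
    and gh: "\<And>x. x \<in> S \<Longrightarrow> \<bar>g x\<bar> \<le> h x"
    and h: "h absolutely_integrable_on {a..b}" "\<And>x. x \<in> {a..b} \<Longrightarrow> 0 \<le> h x"
  shows "G ` S \<in> lmeasurable" and "measure lebesgue (G ` S) \<le> integral {a..b} h"
proof -
  have hS: "h integrable_on S"
    using set_integrable_subset[OF h(1) S(1)] S(2) set_lebesgue_integral_eq_integral(1) by force
  have gS: "(\<lambda>x. \<bar>g x\<bar>) integrable_on S"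
  proof (rule measurable_bounded_by_integrable_imp_integrable_real[OF _ hS _ S(1)])
    show "(\<lambda>x. \<bar>g x\<bar>) \<in> borel_measurable (lebesgue_on S)"
      using borel_measurable_derivative_on_interval[OF cont \<open>a \<le> b\<close> S der] by measurable
  qed (use gh in auto)
  have derS: "\<And>x. x \<in> S \<Longrightarrow> (G has_real_derivative g x) (at x within S)"
    using der has_field_derivative_at_within by blast
  show "G ` S \<in> lmeasurable"
    by (rule measure_image_le_integral_abs_deriv(1)[OF S(1) derS gS])
  have "measure lebesgue (G ` S) \<le> integral S (\<lambda>x. \<bar>g x\<bar>)"
    by (rule measure_image_le_integral_abs_deriv(2)[OF S(1) derS gS])
  also have "\<dots> \<le> integral S h"
    using gS hS gh by (rule integral_le)
  also have "\<dots> \<le> integral {a..b} h"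
    using S(2) hS set_lebesgue_integral_eq_integral(1)[OF h(1)] h(2)
    by (intro integral_subset_le) auto
  finally show "measure lebesgue (G ` S) \<le> integral {a..b} h" .
qed

lemma abs_cont_on_diff_le_integral:
  fixes G g h :: "real \<Rightarrow> real"
  assumes G: "abs_cont_on a b G" and "a \<le> b" and N: "negligible N"
    and der: "\<And>x. x \<in> {a<..<b} - N \<Longrightarrow> (G has_real_derivative g x) (at x)"
    and gh: "\<And>x. x \<in> {a<..<b} - N \<Longrightarrow> g x \<le> h x"
    and h: "h absolutely_integrable_on {a..b}" "\<And>x. x \<in> {a..b} \<Longrightarrow> 0 \<le> h x"
  shows "G b - G a \<le> integral {a..b} h"
proof (cases "G b \<le> G a")
  case True
  have "0 \<le> integral {a..b} h"
    using set_lebesgue_integral_eq_integral(1)[OF h(1)] h(2) by (intro integral_nonneg) auto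
  with True show ?thesis by linarith
next
  case False
  have cont: "continuous_on {a..b} G" using G by (rule abs_cont_on_imp_continuous_on)
  define D where "D = {a<..<b} - N"
  have D: "D \<in> sets lebesgue" "D \<subseteq> {a<..<b}"
    using negligible_imp_sets[OF N] by (auto simp: D_def)
  define S where "S = {x\<in>D. 0 \<le> g x}"
  have "S \<in> sets lebesgue"
  proof -
    have "g \<in> borel_measurable (lebesgue_on D)"
      using borel_measurable_derivative_on_interval[OF cont \<open>a \<le> b\<close> D] der by (auto simp: D_def)
    then have "{x \<in> space (lebesgue_on D). 0 \<le> g x} \<in> sets (lebesgue_on D)" by measurable
    then show ?thesis using D(1) by (simp add: S_def sets_restrict_space_iff)
  qed
  moreover have "S \<subseteq> {a<..<b}" using D(2) by (auto simp: S_def)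
  moreover have "(G has_real_derivative g x) (at x)" if "x \<in> S" for x
    using that der by (auto simp: S_def D_def)
  moreover have "\<bar>g x\<bar> \<le> h x" if "x \<in> S" for x
    using that gh by (auto simp: S_def D_def)
  ultimately have GS: "G ` S \<in> lmeasurable" "measure lebesgue (G ` S) \<le> integral {a..b} h"
    using measure_image_derivative_le_integral[OF cont \<open>a \<le> b\<close> _ _ _ _ h] by blast+
  have null: "negligible (G ` ({a<..<b} - D))"
  proof (rule abs_cont_on_negligible_image[OF G])
    show "negligible ({a<..<b} - D)" using N by (rule negligible_subset) (auto simp: D_def)
  qed auto
  have "G b - G a = measure lebesgue {G a<..<G b}" using False by simp
  also have "\<dots> \<le> measure lebesgue (G ` S \<union> G ` ({a<..<b} - D))"
    using interval_subset_image_nonneg_derivative[OF cont \<open>a \<le> b\<close>, of D g] der GS(1) null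
    by (intro measure_mono_fmeasurable)
      (auto simp: S_def D_def intro: fmeasurable.Un negligible_imp_measurable)
  also have "\<dots> \<le> measure lebesgue (G ` S) + measure lebesgue (G ` ({a<..<b} - D))"
    using GS(1) null by (intro measure_Un_le) (auto simp: negligible_imp_sets)
  also have "\<dots> \<le> integral {a..b} h"
    using GS(2) null by (simp add: negligible_imp_measure0)
  finally show ?thesis .
qed

lemma abs_cont_on_nonincreasing:
  fixes G g :: "real \<Rightarrow> real"
  assumes "abs_cont_on a b G" and "a \<le> b" and "negligible N"
    and "\<And>x. x \<in> {a<..<b} - N \<Longrightarrow> (G has_real_derivative g x) (at x)"
    and "\<And>x. x \<in> {a<..<b} - N \<Longrightarrow> g x \<le> 0"
  shows "G b \<le> G a"
  using abs_cont_on_diff_le_integral[OF assms] by simp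

lemma abs_cont_on_subinterval:
  assumes "abs_cont_on a b G" and "a \<le> c" and "d \<le> b"
  shows "abs_cont_on c d G"
proof -
  have "nonoverlapping_intervals a b I" if "nonoverlapping_intervals c d I" for I
    using that assms(2,3) unfolding nonoverlapping_intervals_def by fastforce
  with assms(1) show ?thesis unfolding abs_cont_on_iff by meson
qed

lemma ln_diff_le:
  fixes A B c :: real
  assumes "0 < c" "c \<le> B" "B \<le> A"
  shows "ln A - ln B \<le> (A - B) / c"
proof -
  have "ln A - ln B = ln (A / B)" using assms by (simp add: ln_div)
  also have "\<dots> \<le> A / B - 1" using assms by (intro ln_le_minus_one) simp
  also have "\<dots> = (A - B) / B" using assms by (simp add: field_simps)
  also have "\<dots> \<le> (A - B) / c" using assms by (intro divide_left_mono) auto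
  finally show ?thesis .
qed

lemma lipschitz_on_ln_max:
  fixes c :: real
  assumes "0 < c"
  shows "(1 / c)-lipschitz_on S (\<lambda>u. ln (max c u))"
proof (rule lipschitz_onI)
  have ln_abs: "\<bar>ln A - ln B\<bar> \<le> \<bar>A - B\<bar> / c" if "c \<le> A" "c \<le> B" for A B
  proof (cases "B \<le> A")
    case True
    then have "ln B \<le> ln A" using that assms by simp
    then show ?thesis using ln_diff_le[OF assms \<open>c \<le> B\<close> True] True by simp
  next
    case False
    then have "ln A \<le> ln B" using that assms by simp
    then show ?thesis using ln_diff_le[OF assms \<open>c \<le> A\<close>, of B] False by simp
  qed
  fix u v :: real
  have "\<bar>ln (max c u) - ln (max c v)\<bar> \<le> \<bar>max c u - max c v\<bar> / c"
    by (rule ln_abs) auto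
  also have "\<dots> \<le> \<bar>u - v\<bar> / c"
    using assms by (intro divide_right_mono) (auto simp: max_def)
  finally show "dist (ln (max c u)) (ln (max c v)) \<le> 1 / c * dist u v"
    by (simp add: dist_real_def)
qed (use assms in simp)

lemma has_real_derivative_ln_max:
  assumes "(y has_real_derivative d) (at t)" and "0 < c" "c < y t"
  shows "((\<lambda>s. ln (max c (y s))) has_real_derivative d / y t) (at t)"
proof -
  have "\<forall>\<^sub>F s in at t. c < y s"
    using DERIV_isCont[OF assms(1)] assms(3) unfolding isCont_def by (rule order_tendstoD)
  then have ev: "\<forall>\<^sub>F s in nhds t. ln (y s) = ln (max c (y s))"
    using assms(3) unfolding eventually_nhds_conv_at by (auto elim: eventually_mono)
  have "((\<lambda>s. ln (y s)) has_real_derivative d / y t) (at t)"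
    using DERIV_chain2[OF DERIV_ln_divide assms(1)] assms(2,3) by simp
  then show ?thesis by (rule DERIV_cong_ev[OF refl ev refl, THEN iffD1])
qed

lemma positive_subsolution_lower_bound:
  fixes y y' q :: "real \<Rightarrow> real"
  assumes y: "abs_cont_on a b y" "a \<le> b" "0 < y b" and N: "negligible N"
    and der: "\<And>x. x \<in> {a<..<b} - N \<Longrightarrow> (y has_real_derivative y' x) (at x)"
    and sub: "\<And>x. x \<in> {a<..<b} - N \<Longrightarrow> 0 < y x \<Longrightarrow> y' x \<le> q x * y x"
    and q: "q absolutely_integrable_on {a..b}" "\<And>x. x \<in> {a..b} \<Longrightarrow> 0 \<le> q x"
  shows "y b * exp (- integral {a..b} q) \<le> y a"
proof (rule ccontr)
  define I where "I = integral {a..b} q"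
  assume "\<not> y b * exp (- integral {a..b} q) \<le> y a"
  then have ya: "y a < y b * exp (- I)" by (simp add: I_def)
  have "0 \<le> I"
    unfolding I_def using set_lebesgue_integral_eq_integral(1)[OF q(1)] q(2) by (intro integral_nonneg) auto
  then have "y b * exp (- I) \<le> y b" using y(3) by (simp add: mult_left_le)
  have "0 < y b * exp (- I)" using y(3) by simp
  \<comment> \<open>c is positive and strictly between y a and y b e^{-I}; on the last stretch [x0, b]
    where y stays above c, ln y grows by at most I.\<close>
  define c where "c = (max (y a) 0 + y b * exp (- I)) / 2"
  have c: "0 < c" "y a < c" "c < y b * exp (- I)" "c < y b"
    using ya \<open>0 < y b * exp (- I)\<close> \<open>y b * exp (- I) \<le> y b\<close> max.cobounded1[of "y a" 0]
      max.cobounded2[of 0 "y a"] max_less_iff_conj[of "y a" 0 "y b * exp (- I)"] c_def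
    by auto
  obtain x0 where x0: "a \<le> x0" "x0 < b" "y x0 = c" and above: "\<And>t. x0 < t \<Longrightarrow> t \<le> b \<Longrightarrow> c < y t"
    using last_crossing[OF abs_cont_on_imp_continuous_on[OF y(1)] y(2), of c] c by auto
  have qx0: "q absolutely_integrable_on {x0..b}"
    using set_integrable_subset[OF q(1)] x0(1) by auto
  define G where "G t = ln (max c (y t))" for t
  have G: "abs_cont_on x0 b G"
    unfolding G_def
    by (rule abs_cont_on_compose_lipschitz[OF abs_cont_on_subinterval[OF y(1) x0(1) order_refl]
          lipschitz_on_ln_max[OF c(1)]])
  have "G b - G x0 \<le> integral {x0..b} q"
  proof (rule abs_cont_on_diff_le_integral[OF G _ N])
    fix t assume t: "t \<in> {x0<..<b} - N"
    then have "c < y t" "t \<in> {a<..<b} - N" using above x0 by auto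
    then show "(G has_real_derivative y' t / y t) (at t)"
      unfolding G_def using has_real_derivative_ln_max[OF der c(1)] by blast
    show "y' t / y t \<le> q t"
      using sub[OF \<open>t \<in> {a<..<b} - N\<close>] \<open>c < y t\<close> c(1) by (simp add: divide_le_eq)
  qed (use x0 q(2) qx0 in auto)
  also have "\<dots> \<le> I"
    unfolding I_def using x0(1) q(2) set_lebesgue_integral_eq_integral(1)[OF qx0]
      set_lebesgue_integral_eq_integral(1)[OF q(1)]
    by (intro integral_subset_le) auto
  finally have "ln (y b) - ln c \<le> I"
    using x0(3) c(4) by (simp add: G_def)
  then have "ln (y b) \<le> ln (exp I * c)" using c(1) by (simp add: ln_mult)
  then have "y b \<le> exp I * c" using c(1) y(3) by simp
  then have "y b * exp (- I) \<le> c" by (simp add: exp_minus field_simps)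
  with c(3) show False by simp
qed

lemma emeasure_lborel_atMost [simp]: "emeasure lborel {..a::real} = \<infinity>"
proof (rule ccontr)
  assume "emeasure lborel {..a} \<noteq> \<infinity>"
  then obtain r where r: "emeasure lborel {..a} = ennreal r" "0 \<le> r"
    by (cases "emeasure lborel {..a}" rule: ennreal_cases) auto
  have "emeasure lborel {a - (r + 1)..a} \<le> emeasure lborel {..a}" by (rule emeasure_mono) auto
  with r show False by simp
qed

lemma emeasure_lborel_atLeast [simp]: "emeasure lborel {a::real..} = \<infinity>"
proof (rule ccontr)
  assume "emeasure lborel {a..} \<noteq> \<infinity>"
  then obtain r where r: "emeasure lborel {a..} = ennreal r" "0 \<le> r"
    by (cases "emeasure lborel {a..}" rule: ennreal_cases) auto
  have "emeasure lborel {a..a + (r + 1)} \<le> emeasure lborel {a..}" by (rule emeasure_mono) auto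
  with r show False by simp
qed

lemma emeasure_finite_if_integrable_powr_bounded_below:
  fixes y :: "real \<Rightarrow> real"
  assumes y: "integrable lebesgue (\<lambda>x. \<bar>y x\<bar> powr p)" and "0 < p" "0 < c"
    and A: "A \<in> sets lebesgue" "\<And>x. x \<in> A \<Longrightarrow> c \<le> \<bar>y x\<bar>"
  shows "emeasure lebesgue A < \<infinity>"
proof -
  have "ennreal (c powr p) * emeasure lebesgue A = (\<integral>\<^sup>+ x. ennreal (c powr p) * indicator A x \<partial>lebesgue)"
    using A(1) by (rule nn_integral_cmult_indicator[symmetric])
  also have "\<dots> \<le> (\<integral>\<^sup>+ x. ennreal (\<bar>y x\<bar> powr p) \<partial>lebesgue)"
    using A(2) \<open>0 < p\<close> \<open>0 < c\<close>
    by (intro nn_integral_mono) (auto simp: indicator_def intro!: ennreal_leI powr_mono2)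
  also have "\<dots> < \<infinity>"
    using integrableD(2)[OF y] by (simp add: less_top)
  finally show ?thesis
    using \<open>0 < c\<close> by (auto simp: ennreal_mult_less_top)
qed

lemma integral_le_nn_integral:
  fixes q :: "real \<Rightarrow> real"
  assumes "\<And>x. 0 \<le> q x" and "set_integrable lebesgue {a..b} q"
    and "(\<integral>\<^sup>+ x. ennreal (q x) \<partial>lebesgue) \<noteq> \<infinity>"
  shows "integral {a..b} q \<le> enn2real (\<integral>\<^sup>+ x. ennreal (q x) \<partial>lebesgue)"
proof -
  have "integral {a..b} q = enn2real (\<integral>\<^sup>+ x. ennreal (indicator {a..b} x * q x) \<partial>lebesgue)"
    using assms(1,2) set_lebesgue_integral_eq_integral(2)[OF assms(2)]
    by (simp add: set_lebesgue_integral_def set_integrable_def integral_eq_nn_integral)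
  also have "\<dots> \<le> enn2real (\<integral>\<^sup>+ x. ennreal (q x) \<partial>lebesgue)"
    using assms(1,3)
    by (intro enn2real_mono nn_integral_mono) (auto simp: indicator_def less_top)
  finally show ?thesis .
qed

lemma in_Lp_indicator:
  assumes "0 < p"
  shows "in_Lp p (indicator {a..b})"
proof -
  have "(\<lambda>x. \<bar>indicator {a..b} x\<bar> powr p) = (indicator {a..b} :: real \<Rightarrow> real)"
    using assms by (auto simp: indicator_def)
  moreover have "integrable lebesgue (indicator {a..b} :: real \<Rightarrow> real)"
    by (rule integrable_real_indicator) (simp_all add: emeasure_lborel_Icc_eq)
  ultimately show ?thesis by (simp add: in_Lp_def borel_measurable_integrable)
qed

lemma is_solution_derivative:
  assumes "is_solution q f y"
  obtains N where "negligible N" "\<And>x. x \<notin> N \<Longrightarrow> (y has_real_derivative q x * y x - f x) (at x)"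
proof -
  have "AE x in lebesgue. \<exists>d. (y has_real_derivative d) (at x) \<and> - d + q x * y x = f x"
    using assms by (simp add: is_solution_def)
  then have "AE x in lebesgue. (y has_real_derivative q x * y x - f x) (at x)"
  proof (rule AE_mp, intro AE_I2 impI)
    fix x assume "\<exists>d. (y has_real_derivative d) (at x) \<and> - d + q x * y x = f x"
    then obtain d where d: "(y has_real_derivative d) (at x)" "- d + q x * y x = f x" by blast
    then have "d = q x * y x - f x" by linarith
    with d(1) show "(y has_real_derivative q x * y x - f x) (at x)" by simp
  qed
  then show thesis
    using that unfolding eventually_ae_filter_negligible by blast
qed

lemma Lp_solution_nonpos:
  fixes q f y :: "real \<Rightarrow> real"
  assumes q: "\<And>x. 0 \<le> q x" "locally_integrable q" "(\<integral>\<^sup>+ x. ennreal (q x) \<partial>lebesgue) \<noteq> \<infinity>"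
    and y: "abs_cont y" "integrable lebesgue (\<lambda>x. \<bar>y x\<bar> powr p)" "0 < p"
    and N: "negligible N" "\<And>x. x \<notin> N \<Longrightarrow> (y has_real_derivative q x * y x - f x) (at x)"
    and f: "\<And>x. 0 \<le> f x"
  shows "y t \<le> 0"
proof (rule ccontr)
  assume "\<not> y t \<le> 0"
  define K where "K = enn2real (\<integral>\<^sup>+ x. ennreal (q x) \<partial>lebesgue)"
  have "y t * exp (- K) \<le> \<bar>y x\<bar>" if "x \<in> {..t}" for x
  proof -
    have "y t * exp (- K) \<le> y t * exp (- integral {x..t} q)"
      using integral_le_nn_integral[OF q(1) _ q(3), of x t] q(2) \<open>\<not> y t \<le> 0\<close>
      by (simp add: K_def locally_integrable_def)
    also have "\<dots> \<le> y x"
    proof (rule positive_subsolution_lower_bound[OF _ _ _ N(1) N(2)])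
      show "abs_cont_on x t y" using y(1) by (simp add: abs_cont_def)
      show "q absolutely_integrable_on {x..t}" using q(2) by (simp add: locally_integrable_def)
    qed (use that \<open>\<not> y t \<le> 0\<close> q(1) f in \<open>auto intro: mult_right_mono\<close>)
    finally show ?thesis by simp
  qed
  then have "emeasure lebesgue {..t} < \<infinity>"
    using \<open>\<not> y t \<le> 0\<close> by (intro emeasure_finite_if_integrable_powr_bounded_below[OF y(2,3)]) auto
  then show False by simp
qed

lemma nonpos_solution_le_minus_one:
  fixes q y :: "real \<Rightarrow> real"
  assumes q: "\<And>x. 0 \<le> q x" and y: "abs_cont y" "\<And>t. y t \<le> 0" and N: "negligible N"
    and der: "\<And>x. x \<notin> N \<Longrightarrow> (y has_real_derivative q x * y x - indicator {0..1} x) (at x)"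
    and "1 \<le> X"
  shows "y X \<le> -1"
proof -
  have "y 1 + 1 \<le> y 0 + 0"
  proof (rule abs_cont_on_nonincreasing[where G = "\<lambda>x. y x + x" and g = "\<lambda>x. q x * y x"])
    show "abs_cont_on 0 1 (\<lambda>x. y x + x)"
      using y(1) abs_cont_on_ident unfolding abs_cont_def by (intro abs_cont_on_add) auto
  qed (use N der q y(2) in \<open>auto intro!: derivative_eq_intros mult_nonneg_nonpos\<close>)
  moreover have "y X \<le> y 1"
  proof (rule abs_cont_on_nonincreasing[where G = y and g = "\<lambda>x. q x * y x - indicator {0..1} x"])
    show "q x * y x - indicator {0..1} x \<le> 0" for x
      using mult_nonneg_nonpos[OF q y(2), of x x] by (simp add: indicator_def)
  qed (use y(1) N der \<open>1 \<le> X\<close> in \<open>auto simp: abs_cont_def\<close>)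
  ultimately show ?thesis using y(2)[of 0] by simp
qed

theorem lemma2p2:
  fixes q :: "real \<Rightarrow> real" and p :: real
  assumes "\<And>x. 0 \<le> q x"
    and "locally_integrable q"
    and "1 \<le> p"
    and "correctly_solvable q p"
  shows "(\<integral>\<^sup>+ x. ennreal (q x) \<partial>lebesgue) = \<infinity>"
proof (rule ccontr)
  assume fin: "(\<integral>\<^sup>+ x. ennreal (q x) \<partial>lebesgue) \<noteq> \<infinity>"
  have "0 < p" using assms(3) by simp
  obtain y where "in_Lp p y" "is_solution q (indicator {0..1}) y"
    using assms(4) in_Lp_indicator[OF \<open>0 < p\<close>] unfolding correctly_solvable_def by blast
  then have y: "abs_cont y" "integrable lebesgue (\<lambda>x. \<bar>y x\<bar> powr p)"
    by (auto simp: is_solution_def in_Lp_def)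
  obtain N where N: "negligible N"
    "\<And>x. x \<notin> N \<Longrightarrow> (y has_real_derivative q x * y x - indicator {0..1} x) (at x)"
    using is_solution_derivative[OF \<open>is_solution q (indicator {0..1}) y\<close>] by blast
  have nonpos: "y t \<le> 0" for t
    using Lp_solution_nonpos[OF assms(1,2) fin y \<open>0 < p\<close> N] by simp
  have "1 \<le> \<bar>y X\<bar>" if "X \<in> {1..}" for X
    using nonpos_solution_le_minus_one[OF assms(1) y(1) nonpos N] that by force
  then have "emeasure lebesgue {1::real..} < \<infinity>"
    by (intro emeasure_finite_if_integrable_powr_bounded_below[OF y(2) \<open>0 < p\<close> zero_less_one]) auto
  then show False by simp
qed

end
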